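(* Let $\chi_{\Delta}(\mathbb{R}^{n})$ denote the minimum number of colors needed to color $\mathbb{R}^{n}$ so that there is no monochromatic equilateral triangle with side length $1$. Then \[ \chi_{\Delta}\left(\mathbb{R}^{n}\right)>(1+c+o(1))^{n} \] as $n\to\infty$, where $c=0.01446\dots$; that is, $\chi_{\Delta}(\mathbb{R}^n) > (1.01446+o(1))^n$.
   Context: A monochromatic equilateral triangle with side length $1$ in a coloring of $\mathbb{R}^n$ means three points $x,y,z\in\mathbb{R}^n$ of the same color with $\|x-y\|_2=\|y-z\|_2=\|z-x\|_2=1$. The $o(1)$ term tends to $0$ as $n\to\infty$. *)

theory Defs
  imports "HOL-Analysis.Analysis"
begin

text \<open>
  Since the dimension \<^term>\<open>n\<close> tends to infinity, the points of \<open>n\<close>-dimensional space are the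
  elements of \<^term>\<open>topspace (Euclidean_space n)\<close>, that is, the real sequences that vanish from
  index \<^term>\<open>n\<close> on. The metric is the Euclidean one on the first \<^term>\<open>n\<close> coordinates.
\<close>

definition euclid_dist :: "nat \<Rightarrow> (nat \<Rightarrow> real) \<Rightarrow> (nat \<Rightarrow> real) \<Rightarrow> real" where
  "euclid_dist n x y = L2_set (\<lambda>i. x i - y i) {..<n}"

definition mono_unit_triangle ::
  "nat \<Rightarrow> ((nat \<Rightarrow> real) \<Rightarrow> nat) \<Rightarrow> (nat \<Rightarrow> real) \<Rightarrow> (nat \<Rightarrow> real) \<Rightarrow> (nat \<Rightarrow> real) \<Rightarrow> bool" where
  "mono_unit_triangle n f x y z \<longleftrightarrow>
     x \<in> topspace (Euclidean_space n) \<and> y \<in> topspace (Euclidean_space n) \<and>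
     z \<in> topspace (Euclidean_space n) \<and> f x = f y \<and> f y = f z \<and>
     euclid_dist n x y = 1 \<and> euclid_dist n y z = 1 \<and> euclid_dist n z x = 1"

definition triangle_colorable :: "nat \<Rightarrow> nat \<Rightarrow> bool" where
  "triangle_colorable n k \<longleftrightarrow>
     (\<exists>f. f \<in> topspace (Euclidean_space n) \<rightarrow> {..<k} \<and> (\<nexists>x y z. mono_unit_triangle n f x y z))"

definition chi_triangle :: "nat \<Rightarrow> nat" where
  "chi_triangle n = (LEAST k. triangle_colorable n k)"

text \<open>
  Finitely many colors suffice in every dimension, so the minimum above is attained: color a point
  by the residues modulo \<open>n + 3\<close> of the indices of its cell in the cubical grid of
  mesh \<open>1 / (n + 1)\<close>.
\<close>

lemma triangle_colorable_exists: "\<exists>k. triangle_colorable n k"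
proof -
  define g :: "(nat \<Rightarrow> real) \<Rightarrow> int list" where
    "g x = map (\<lambda>i. \<lfloor>x i * (n + 1)\<rfloor> mod (int n + 3)) [0..<n]" for x
  have "range g \<subseteq> {xs. set xs \<subseteq> {0..<int n + 3} \<and> length xs = n}"
    by (auto simp: g_def)
  then have fin: "finite (range g)"
    by (rule finite_subset) (simp add: finite_lists_length_eq)
  obtain h where h: "bij_betw h (range g) {0..<card (range g)}"
    using ex_bij_betw_finite_nat[OF fin] by blast
  have "euclid_dist n x y < 1" if same: "g x = g y" and le: "euclid_dist n x y \<le> 1" for x y
  proof -
    have bd: "\<bar>x i - y i\<bar> \<le> 1 / (n + 1)" if i: "i < n" for i
    proof -
      define a b where "a = \<lfloor>x i * (n + 1)\<rfloor>" and "b = \<lfloor>y i * (n + 1)\<rfloor>"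
      have "\<bar>x i - y i\<bar> = L2_set (\<lambda>i. x i - y i) {i}" by simp
      also have "\<dots> \<le> L2_set (\<lambda>i. x i - y i) {..<n}"
        unfolding L2_set_def using i by (intro real_sqrt_le_mono sum_mono2) auto
      finally have "\<bar>x i - y i\<bar> \<le> 1" using le by (simp add: euclid_dist_def)
      then have "\<bar>x i - y i\<bar> * (n + 1) \<le> 1 * real (n + 1)" by (intro mult_right_mono) auto
      moreover have e: "\<bar>x i - y i\<bar> * (n + 1) = \<bar>x i * (n + 1) - y i * (n + 1)\<bar>"
        by (simp add: abs_mult flip: left_diff_distrib)
      ultimately have "\<bar>x i * (n + 1) - y i * (n + 1)\<bar> \<le> n + 1" by (simp only: mult_1)
      then have "\<bar>a - b\<bar> < int n + 3" unfolding a_def b_def by linarith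
      moreover have "a mod (int n + 3) = b mod (int n + 3)"
        using same i by (simp add: g_def a_def b_def)
      then have "int n + 3 dvd a - b" by (simp add: mod_eq_dvd_iff)
      ultimately have "a = b" using zdvd_imp_le[of "int n + 3" "\<bar>a - b\<bar>"] by force
      then have "\<bar>x i * (n + 1) - y i * (n + 1)\<bar> \<le> 1" unfolding a_def b_def by linarith
      then show ?thesis using e by (simp add: field_simps)
    qed
    have "euclid_dist n x y \<le> (\<Sum>i<n. \<bar>x i - y i\<bar>)"
      unfolding euclid_dist_def by (rule L2_set_le_sum_abs)
    also have "\<dots> \<le> (\<Sum>i<n. 1 / (n + 1))" using bd by (intro sum_mono) auto
    also have "\<dots> < 1" by simp
    finally show ?thesis .
  qed
  then have ne: "euclid_dist n x y \<noteq> 1" if "g x = g y" for x y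
    using that by fastforce
  have inj: "g x = g y" if "h (g x) = h (g y)" for x y
    using h that by (auto simp: bij_betw_def dest: inj_onD)
  have "triangle_colorable n (card (range g))"
    unfolding triangle_colorable_def
  proof (intro exI conjI)
    show "h \<circ> g \<in> topspace (Euclidean_space n) \<rightarrow> {..<card (range g)}"
      using bij_betwE[OF h] by auto
    show "\<nexists>x y z. mono_unit_triangle n (h \<circ> g) x y z"
      using ne inj by (auto simp: mono_unit_triangle_def)
  qed
  then show ?thesis ..
qed

end

theory Submission
  imports Defs
begin

text \<open>
  Let \<open>q\<close> be a power of two with \<open>14 q \<le> n < 28 q\<close>, and look at the vertices of the cube of dimension
  \<open>14 q\<close>, scaled so that Hamming distance \<open>2 q\<close> becomes Euclidean distance 1. Let \<open>A\<close> be a color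
  class. The neighbours in \<open>A\<close> of a vertex of \<open>A\<close> correspond to \<open>2 q\<close>-sets no two of which meet in
  exactly \<open>q\<close> points, and a rank argument modulo 2 in the manner of Frankl and Wilson shows that
  they are exponentially few. On the other hand, the least eigenvalue of the distance-\<open>2 q\<close> graph
  of the cube (a Krawtchouk polynomial) is tiny in absolute value, so a dense \<open>A\<close> would induce a
  graph of large average degree. Hence \<open>A\<close> has density at most \<open>6 / 2\<^sup>q\<close>, and \<open>2 powr (1 / 28)\<close>
  exceeds \<open>1.01446\<close>, with room to absorb the factor 6.
\<close>

subsection \<open>Set families with a forbidden intersection size\<close>

text \<open>An odd coefficient would be coprime to \<open>2 ^ r\<close>. But \<open>i\<close> times
  it equals \<open>2 ^ r\<close> times another binomial coefficient, so \<open>2 ^ r\<close> would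
  divide \<open>i\<close>.\<close>

lemma even_binomial_two_power:
  fixes r i :: nat
  assumes "0 < i" "i < 2 ^ r"
  shows "even ((2 ^ r) choose i)"
proof (rule ccontr)
  assume "odd ((2 ^ r) choose i)"
  then have "coprime (2 ^ r) ((2 ^ r) choose i)"
    by simp
  moreover have "2 ^ r dvd i * ((2 ^ r) choose i)"
    using times_binomial_minus1_eq[OF assms(1), of "2 ^ r"] by simp
  ultimately have "2 ^ r dvd i"
    using coprime_dvd_mult_left_iff by blast
  then show False
    using assms by (auto dest: dvd_imp_le)
qed

text \<open>A case of Lucas' theorem. Write \<open>m = 2 ^ r + j\<close> and expand by Vandermonde:
  every term with \<open>k > 0\<close> is even, so only the parity of
  \<open>j choose (2 ^ r - 1)\<close> matters.\<close>

lemma odd_binomial_two_power_pred_iff: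
  fixes r m :: nat
  assumes "m < 2 * 2 ^ r"
  shows "odd (m choose (2 ^ r - 1)) \<longleftrightarrow> m = 2 ^ r - 1 \<or> m = 2 * 2 ^ r - 1"
proof -
  let ?q = "2 ^ r :: nat"
  have q: "?q \<ge> 1"
    by simp
  have small: "odd (j choose (?q - 1)) \<longleftrightarrow> j = ?q - 1" if "j < ?q" for j
  proof (cases "j = ?q - 1")
    case False
    then have "j < ?q - 1" using that by linarith
    then show ?thesis by (simp add: binomial_eq_0)
  qed simp
  show ?thesis
  proof (cases "m < ?q")
    case True
    then show ?thesis using small[OF True] q by linarith
  next
    case False
    define j where "j = m - ?q"
    have m: "m = ?q + j" and j: "j < ?q"
      using False assms by (auto simp: j_def)
    have "m choose (?q - 1) = (\<Sum>k\<le>?q - 1. (?q choose k) * (j choose (?q - 1 - k)))"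
      unfolding m by (rule vandermonde[symmetric])
    also have "\<dots> = (?q choose 0) * (j choose (?q - 1 - 0)) +
        (\<Sum>k\<in>{..?q - 1} - {0}. (?q choose k) * (j choose (?q - 1 - k)))"
      by (rule sum.remove) auto
    finally have split: "m choose (?q - 1) = (j choose (?q - 1)) +
        (\<Sum>k\<in>{..?q - 1} - {0}. (?q choose k) * (j choose (?q - 1 - k)))"
      by simp
    have "even ((?q choose k) * (j choose (?q - 1 - k)))" if "k \<in> {..?q - 1} - {0}" for k
    proof -
      have "even (?q choose k)"
      proof (rule even_binomial_two_power)
        show "0 < k" using that by auto
        have "k \<le> ?q - 1" using that by auto
        then show "k < ?q" using q by linarith
      qed
      then show ?thesis by simp
    qed
    then have "even (\<Sum>k\<in>{..?q - 1} - {0}. (?q choose k) * (j choose (?q - 1 - k)))"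
      by (intro dvd_sum)
    then have "odd (m choose (?q - 1)) \<longleftrightarrow> odd (j choose (?q - 1))"
      using split by simp
    also have "\<dots> \<longleftrightarrow> m = ?q - 1 \<or> m = 2 * ?q - 1"
      using small[OF j] m q by linarith
    finally show ?thesis .
  qed
qed

text \<open>
  The hypothesis says that the rows of the incidence matrix are orthonormal over the field with two
  elements, so they are linearly independent. Linear independence appears here as the injectivity
  of the map sending a set of rows to the support of their sum.
\<close>

lemma card_le_if_orthonormal_mod_2:
  fixes inc :: "'a \<Rightarrow> 'b \<Rightarrow> bool"
  assumes fin: "finite F" "finite T"
    and orth: "\<And>x y. x \<in> F \<Longrightarrow> y \<in> F \<Longrightarrow> odd (card {t \<in> T. inc x t \<and> inc y t}) \<longleftrightarrow> x = y"
  shows "card F \<le> card T"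
proof -
  define g where "g G = {t \<in> T. odd (card {y \<in> G. inc y t})}" for G
  \<comment> \<open>Double counting modulo 2 of the pairs \<open>y\<close> in \<open>G\<close>,
    \<open>t\<close> in \<open>T\<close> with \<open>inc x t\<close> and \<open>inc y t\<close>: by
    \<open>orth\<close> only \<open>y = x\<close> contributes an odd number, so \<open>g G\<close>
    determines whether \<open>x\<close> lies in \<open>G\<close>.\<close>
  have mem: "x \<in> G \<longleftrightarrow> odd (card {t \<in> g G. inc x t})" if x: "x \<in> F" and G: "G \<subseteq> F" for x G
  proof -
    have finG: "finite G" using G fin finite_subset by blast
    let ?Tx = "{t \<in> T. inc x t}"
    have "(\<Sum>t\<in>?Tx. card {y \<in> G. inc y t}) = (\<Sum>y\<in>G. card {t \<in> ?Tx. inc y t})"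
      using fin finG sum_multicount_gen[of ?Tx G "\<lambda>t y. inc y t" "\<lambda>y. card {t \<in> ?Tx. inc y t}"]
      by auto
    moreover have "{t \<in> ?Tx. odd (card {y \<in> G. inc y t})} = {t \<in> g G. inc x t}"
      by (auto simp: g_def)
    moreover have "{y \<in> G. odd (card {t \<in> ?Tx. inc y t})} = {y \<in> G. x = y}"
      using orth[OF x] G by (auto simp: conj_assoc)
    moreover have "card {y \<in> G. x = y} = (if x \<in> G then 1 else 0)"
    proof -
      have "{y \<in> G. x = y} = (if x \<in> G then {x} else {})" by auto
      then show ?thesis by simp
    qed
    moreover have "even (\<Sum>t\<in>?Tx. card {y \<in> G. inc y t}) \<longleftrightarrow>
        even (card {t \<in> ?Tx. odd (card {y \<in> G. inc y t})})"
      using fin by (intro even_sum_iff) simp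
    moreover note even_sum_iff[OF finG, of "\<lambda>y. card {t \<in> ?Tx. inc y t}"]
    ultimately have "even (card {t \<in> g G. inc x t}) \<longleftrightarrow> even (if x \<in> G then 1 else 0 :: nat)"
      by presburger
    then show ?thesis by simp
  qed
  have "inj_on g (Pow F)"
  proof (rule inj_onI)
    fix G H assume "G \<in> Pow F" "H \<in> Pow F" "g G = g H"
    then have "x \<in> G \<longleftrightarrow> x \<in> H" if "x \<in> F" for x
      using mem[OF that, of G] mem[OF that, of H] by simp
    then show "G = H" using \<open>G \<in> Pow F\<close> \<open>H \<in> Pow F\<close> by auto
  qed
  moreover have "g ` Pow F \<subseteq> Pow T"
    by (auto simp: g_def)
  ultimately have "card (Pow F) \<le> card (Pow T)"
    using fin by (metis card_inj_on_le finite_Pow_iff)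
  then show ?thesis
    using fin by (simp add: card_Pow)
qed

text \<open>Take the incidence of members of \<open>F\<close> with the
  \<open>(q - 1)\<close>-subsets of \<open>V\<close>. The inner product of two rows is
  \<open>card (u \<inter> v) choose (q - 1)\<close>, odd only for intersections of size
  \<open>q - 1\<close>, which is excluded, or \<open>2 * q - 1\<close>, which means
  \<open>u = v\<close>.\<close>

lemma card_forbidden_intersection_le:
  fixes q r :: nat
  assumes V: "finite V" and q: "q = 2 ^ r"
    and F: "\<And>u. u \<in> F \<Longrightarrow> u \<subseteq> V \<and> card u = 2 * q - 1"
    and avoid: "\<And>u v. u \<in> F \<Longrightarrow> v \<in> F \<Longrightarrow> card (u \<inter> v) \<noteq> q - 1"
  shows "card F \<le> card V choose (q - 1)"
proof -
  have "F \<subseteq> Pow V" using F by auto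
  then have finF: "finite F" using V by (meson finite_Pow_iff finite_subset)
  let ?T = "{t. t \<subseteq> V \<and> card t = q - 1}"
  have "card F \<le> card ?T"
  proof (rule card_le_if_orthonormal_mod_2[where inc = "\<lambda>u t. t \<subseteq> u"])
    show "finite ?T" using V by simp
    fix u v assume u: "u \<in> F" and v: "v \<in> F"
    have fin: "finite u" "finite v" using F u v V finite_subset by blast+
    have "{t \<in> ?T. t \<subseteq> u \<and> t \<subseteq> v} = {t. t \<subseteq> u \<inter> v \<and> card t = q - 1}"
      using F[OF u] by auto
    then have eq: "card {t \<in> ?T. t \<subseteq> u \<and> t \<subseteq> v} = card (u \<inter> v) choose (q - 1)"
      using n_subsets[of "u \<inter> v" "q - 1"] fin by auto
    have le: "card (u \<inter> v) \<le> 2 * q - 1"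
      using F[OF u] card_mono[OF fin(1), of "u \<inter> v"] by simp
    have q1: "q \<ge> 1" using q by simp
    have "odd (card (u \<inter> v) choose (q - 1)) \<longleftrightarrow> card (u \<inter> v) = q - 1 \<or> card (u \<inter> v) = 2 * q - 1"
      using odd_binomial_two_power_pred_iff[of "card (u \<inter> v)" r] le q1 q by auto
    also have "\<dots> \<longleftrightarrow> card (u \<inter> v) = 2 * q - 1"
      using avoid[OF u v] by simp
    also have "\<dots> \<longleftrightarrow> u = v"
    proof
      assume "card (u \<inter> v) = 2 * q - 1"
      then have "u \<inter> v = u" "u \<inter> v = v"
        using F[OF u] F[OF v] by (simp_all only: card_subset_eq[OF fin(1)] card_subset_eq[OF fin(2)] Int_lower1 Int_lower2)
      then show "u = v" by blast
    qed (use F[OF u] in auto)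
    finally show "odd (card {t \<in> ?T. t \<subseteq> u \<and> t \<subseteq> v}) \<longleftrightarrow> u = v"
      using eq by simp
  qed (rule finF)
  then show ?thesis using V by (simp add: n_subsets)
qed

text \<open>Deleting a fixed point \<open>i\<close> from the members through \<open>i\<close> lowers
  set sizes and intersections by one, which is the previous situation. Summing over \<open>i\<close>
  counts each member \<open>2 * q\<close> times.\<close>

lemma card_forbidden_half_intersection_le:
  fixes q r :: nat
  assumes V: "finite V" and q: "q = 2 ^ r"
    and F: "\<And>u. u \<in> F \<Longrightarrow> u \<subseteq> V \<and> card u = 2 * q"
    and avoid: "\<And>u v. u \<in> F \<Longrightarrow> v \<in> F \<Longrightarrow> card (u \<inter> v) \<noteq> q"
  shows "2 * q * card F \<le> card V * (card V choose (q - 1))"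
proof -
  have "F \<subseteq> Pow V" using F by auto
  then have finF: "finite F" using V by (meson finite_Pow_iff finite_subset)
  have q1: "q \<ge> 1" using q by simp
  have star: "card {u \<in> F. i \<in> u} \<le> card V choose (q - 1)" for i
  proof -
    let ?G = "(\<lambda>u. u - {i}) ` {u \<in> F. i \<in> u}"
    have "inj_on (\<lambda>u. u - {i}) {u \<in> F. i \<in> u}"
      by (rule inj_onI) blast
    then have "card {u \<in> F. i \<in> u} = card ?G"
      by (simp add: card_image)
    also have "\<dots> \<le> card V choose (q - 1)"
    proof (rule card_forbidden_intersection_le[OF V q])
      fix u' assume "u' \<in> ?G"
      then show "u' \<subseteq> V \<and> card u' = 2 * q - 1" using F by auto
    next
      fix u' v' assume "u' \<in> ?G" "v' \<in> ?G"
      then obtain u v where u: "u \<in> F" "i \<in> u" "u' = u - {i}" and v: "v \<in> F" "i \<in> v" "v' = v - {i}"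
        by auto
      have "u' \<inter> v' = u \<inter> v - {i}" using u v by auto
      then have "card (u' \<inter> v') = card (u \<inter> v) - 1" using u v by simp
      \<comment> \<open>Both sets contain \<open>i\<close>, so the truncated subtraction of 1 is a
        genuine one.\<close>
      moreover have "finite (u \<inter> v)" using F[OF u(1)] V finite_subset by blast
      then have "card (u \<inter> v) \<ge> 1" using u v
        by (metis Int_iff One_nat_def Suc_leI card_gt_0_iff empty_iff)
      ultimately show "card (u' \<inter> v') \<noteq> q - 1"
        using avoid[OF u(1) v(1)] q1 by linarith
    qed
    finally show ?thesis .
  qed
  have "(\<Sum>u\<in>F. card {i \<in> V. i \<in> u}) = (\<Sum>u\<in>F. 2 * q)"
  proof (rule sum.cong[OF refl])
    fix u assume "u \<in> F"
    then have "{i \<in> V. i \<in> u} = u" "card u = 2 * q" using F by auto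
    then show "card {i \<in> V. i \<in> u} = 2 * q" by simp
  qed
  moreover have "(\<Sum>u\<in>F. card {i \<in> V. i \<in> u}) = (\<Sum>i\<in>V. card {u \<in> F. i \<in> u})"
    using finF V by (intro sum_multicount_gen) auto
  moreover have "\<dots> \<le> (\<Sum>i\<in>V. card V choose (q - 1))"
    using star by (rule sum_mono)
  ultimately show ?thesis by (simp add: mult.commute)
qed

subsection \<open>Fourier analysis on the cube\<close>

text \<open>The characters of the group of subsets under symmetric difference.\<close>

definition walsh :: "'a set \<Rightarrow> 'a set \<Rightarrow> real" where
  "walsh S U = (-1) ^ card (S \<inter> U)"

text \<open>The eigenvalue of the distance-\<open>w\<close> graph of the cube at the character
  \<open>walsh S\<close>; it is the Krawtchouk polynomial evaluated at
  \<open>card S\<close>.\<close>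

definition krawtchouk :: "'a set \<Rightarrow> nat \<Rightarrow> 'a set \<Rightarrow> real" where
  "krawtchouk V w S = (\<Sum>U | U \<subseteq> V \<and> card U = w. walsh S U)"

lemma walsh_sym_diff:
  assumes "finite S"
  shows "walsh S (sym_diff x y) = walsh S x * walsh S y"
proof -
  have "card (S \<inter> x) = card (S \<inter> (x - y)) + card (S \<inter> x \<inter> y)"
    "card (S \<inter> y) = card (S \<inter> (y - x)) + card (S \<inter> x \<inter> y)"
    "card (S \<inter> sym_diff x y) = card (S \<inter> (x - y)) + card (S \<inter> (y - x))"
    using assms by (subst card_Un_disjoint[symmetric]; auto intro!: arg_cong[where f = card])+
  then show ?thesis
    by (simp add: walsh_def power_add flip: power_mult_distrib)
qed

text \<open>The sum factors into a product over \<open>V\<close> of terms 1 + 1 or 1 - 1, and any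
  element of \<open>U\<close> gives a zero factor.\<close>

lemma sum_walsh_eq:
  assumes V: "finite V" and U: "U \<subseteq> V"
  shows "(\<Sum>S\<in>Pow V. walsh S U) = (if U = {} then 2 ^ card V else 0)"
proof -
  have "(\<Sum>S\<in>Pow V. walsh S U) = (\<Sum>S\<in>Pow V. \<Prod>i\<in>S. if i \<in> U then -1 else 1)"
  proof (rule sum.cong[OF refl])
    fix S assume "S \<in> Pow V"
    then have "finite S" using V finite_subset by auto
    then show "walsh S U = (\<Prod>i\<in>S. if i \<in> U then -1 else 1)"
      by (simp add: walsh_def prod.If_cases)
  qed
  also have "\<dots> = (\<Prod>i\<in>V. (if i \<in> U then -1 else 1) + 1)"
    using V by (simp add: prod_add)
  also have "\<dots> = (if U = {} then 2 ^ card V else 0)"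
  proof (cases "U = {}")
    case False
    then obtain i where "i \<in> U" by auto
    then have "(\<Prod>i\<in>V. (if i \<in> U then -1 else 1) + (1::real)) = 0"
      using U V by (intro prod_zero) auto
    then show ?thesis using False by simp
  qed simp
  finally show ?thesis .
qed

text \<open>Expanding the square and multiplying characters gives \<open>walsh S\<close> at the
  symmetric difference of \<open>x\<close>, \<open>y\<close> and \<open>U\<close>; orthogonality
  keeps the pairs for which this is empty.\<close>

lemma sum_walsh_transform_sq:
  assumes V: "finite V" and A: "A \<subseteq> Pow V" and U: "U \<subseteq> V"
  shows "(\<Sum>S\<in>Pow V. (\<Sum>x\<in>A. walsh S x)\<^sup>2 * walsh S U) =
    2 ^ card V * card {(x, y). x \<in> A \<and> y \<in> A \<and> sym_diff x y = U}"
proof -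
  have finA: "finite A" using A V by (meson finite_Pow_iff finite_subset)
  have "(\<Sum>S\<in>Pow V. (\<Sum>x\<in>A. walsh S x)\<^sup>2 * walsh S U) =
      (\<Sum>S\<in>Pow V. \<Sum>(x, y)\<in>A \<times> A. walsh S (sym_diff (sym_diff x y) U))"
  proof (rule sum.cong[OF refl])
    fix S assume "S \<in> Pow V"
    then have "finite S" using V finite_subset by auto
    moreover have "(\<Sum>x\<in>A. walsh S x)\<^sup>2 = (\<Sum>(x, y)\<in>A \<times> A. walsh S x * walsh S y)"
      unfolding power2_eq_square sum_product sum.cartesian_product ..
    ultimately show "(\<Sum>x\<in>A. walsh S x)\<^sup>2 * walsh S U =
        (\<Sum>(x, y)\<in>A \<times> A. walsh S (sym_diff (sym_diff x y) U))"
      by (simp only: walsh_sym_diff sum_distrib_right split_def)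
  qed
  also have "\<dots> = (\<Sum>(x, y)\<in>A \<times> A. \<Sum>S\<in>Pow V. walsh S (sym_diff (sym_diff x y) U))"
    by (subst sum.swap) (simp add: split_def)
  also have "\<dots> = (\<Sum>(x, y)\<in>A \<times> A. if sym_diff x y = U then 2 ^ card V else 0)"
  proof (rule sum.cong[OF refl], clarify)
    fix x y assume xy: "x \<in> A" "y \<in> A"
    then have "sym_diff (sym_diff x y) U \<subseteq> V" using A U by blast
    moreover have "sym_diff (sym_diff x y) U = {} \<longleftrightarrow> sym_diff x y = U" by blast
    ultimately show "(\<Sum>S\<in>Pow V. walsh S (sym_diff (sym_diff x y) U)) =
        (if sym_diff x y = U then 2 ^ card V else 0)"
      using sum_walsh_eq[OF V, of "sym_diff (sym_diff x y) U"] by presburger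
  qed
  also have "\<dots> = (\<Sum>p\<in>A \<times> A. if sym_diff (fst p) (snd p) = U then 2 ^ card V else 0)"
    by (simp add: split_def)
  also have "\<dots> = 2 ^ card V * card {p \<in> A \<times> A. sym_diff (fst p) (snd p) = U}"
    using finA by (simp add: sum.If_cases Int_def)
  also have "{p \<in> A \<times> A. sym_diff (fst p) (snd p) = U} =
      {(x, y). x \<in> A \<and> y \<in> A \<and> sym_diff x y = U}"
    by auto
  finally show ?thesis .
qed

lemma parseval_walsh:
  assumes V: "finite V" and A: "A \<subseteq> Pow V"
  shows "(\<Sum>S\<in>Pow V. (\<Sum>x\<in>A. walsh S x)\<^sup>2) = 2 ^ card V * card A"
proof -
  have "{(x, y). x \<in> A \<and> y \<in> A \<and> sym_diff x y = {}} = (\<lambda>x. (x, x)) ` A"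
    by auto
  then have "card {(x, y). x \<in> A \<and> y \<in> A \<and> sym_diff x y = {}} = card A"
    by (simp add: card_image inj_on_def)
  then show ?thesis
    using sum_walsh_transform_sq[OF V A, of "{}"] by (simp add: walsh_def)
qed

text \<open>The spectral form of the number of ordered pairs in \<open>A\<close> at Hamming distance
  \<open>w\<close>, obtained by summing the previous identity over the \<open>w\<close>-sets
  \<open>U\<close>.\<close>

lemma sum_walsh_transform_sq_krawtchouk:
  assumes V: "finite V" and A: "A \<subseteq> Pow V"
  shows "(\<Sum>S\<in>Pow V. (\<Sum>x\<in>A. walsh S x)\<^sup>2 * krawtchouk V w S) =
    2 ^ card V * card {(x, y). x \<in> A \<and> y \<in> A \<and> card (sym_diff x y) = w}"
proof -
  let ?U = "{U. U \<subseteq> V \<and> card U = w}"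
  let ?P = "\<lambda>U. {(x, y). x \<in> A \<and> y \<in> A \<and> sym_diff x y = U}"
  have finA: "finite A" using A V by (meson finite_Pow_iff finite_subset)
  have "(\<Sum>S\<in>Pow V. (\<Sum>x\<in>A. walsh S x)\<^sup>2 * krawtchouk V w S) =
      (\<Sum>U\<in>?U. \<Sum>S\<in>Pow V. (\<Sum>x\<in>A. walsh S x)\<^sup>2 * walsh S U)"
    unfolding krawtchouk_def sum_distrib_left by (rule sum.swap)
  also have "\<dots> = (\<Sum>U\<in>?U. 2 ^ card V * real (card (?P U)))"
    by (intro sum.cong refl) (simp add: sum_walsh_transform_sq[OF V A])
  also have "\<dots> = 2 ^ card V * (\<Sum>U\<in>?U. card (?P U))"
    by (simp add: sum_distrib_left)
  also have "(\<Sum>U\<in>?U. card (?P U)) = card (\<Union>U\<in>?U. ?P U)"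
  proof (rule card_UN_disjoint[symmetric])
    have "?P U \<subseteq> A \<times> A" for U by auto
    then show "\<forall>U\<in>?U. finite (?P U)" using finA by (meson finite_SigmaI finite_subset)
  qed (use V in auto)
  also have "(\<Union>U\<in>?U. ?P U) = {(x, y). x \<in> A \<and> y \<in> A \<and> card (sym_diff x y) = w}"
  proof -
    have "sym_diff x y \<subseteq> V" if "x \<in> A" "y \<in> A" for x y
      using that A by blast
    then show ?thesis by auto
  qed
  finally show ?thesis .
qed

lemma walsh_mult_self [simp]: "walsh S U * walsh S U = 1"
  by (simp add: walsh_def flip: power_mult_distrib)

section \<open>Krawtchouk polynomials: symmetries, recurrence and a lower bound\<close>

lemma krawtchouk_empty:
  assumes "finite V"
  shows "krawtchouk V w {} = (card V choose w)"
  using assms by (simp add: krawtchouk_def walsh_def n_subsets)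

text \<open>Bijections from \<open>S\<close> to \<open>S'\<close> and between the complements glue
  to a permutation \<open>h\<close> of \<open>V\<close>, which permutes the
  \<open>w\<close>-subsets.\<close>

lemma krawtchouk_cong_card:
  assumes V: "finite V" and S: "S \<subseteq> V" "S' \<subseteq> V" and card: "card S = card S'"
  shows "krawtchouk V w S = krawtchouk V w S'"
proof -
  have fin: "finite S" "finite S'" "finite (V - S)" "finite (V - S')"
    using V S finite_subset by auto
  obtain f where f: "bij_betw f S S'"
    using finite_same_card_bij[OF fin(1,2) card] by blast
  obtain g where g: "bij_betw g (V - S) (V - S')"
    using finite_same_card_bij[OF fin(3,4)] V S card by (auto simp: card_Diff_subset fin)
  define h where "h x = (if x \<in> S then f x else g x)" for x
  have hS: "bij_betw h S S'"
    using f by (rule bij_betw_cong[THEN iffD1, rotated]) (simp add: h_def)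
  have hC: "bij_betw h (V - S) (V - S')"
    using g by (rule bij_betw_cong[THEN iffD1, rotated]) (simp add: h_def)
  have "bij_betw h (S \<union> (V - S)) (S' \<union> (V - S'))"
    using hS hC by (rule bij_betw_combine) auto
  then have h: "bij_betw h V V"
    using S by (simp add: Un_absorb1)
  have inj: "inj_on h V" and img: "h ` V = V" "h ` S = S'"
    using h hS by (auto simp: bij_betw_def)
  show ?thesis
    unfolding krawtchouk_def
  proof (rule sum.reindex_bij_betw[symmetric, of "image h" _ _ "walsh S'", THEN trans, symmetric])
    show "bij_betw (image h) {U. U \<subseteq> V \<and> card U = w} {U. U \<subseteq> V \<and> card U = w}"
    proof (rule bij_betw_subset[OF bij_betw_Pow[OF h]])
      show "{U. U \<subseteq> V \<and> card U = w} \<subseteq> Pow V" by auto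
      show "image h ` {U. U \<subseteq> V \<and> card U = w} = {U. U \<subseteq> V \<and> card U = w}"
      proof (intro subset_antisym subsetI)
        fix T assume "T \<in> image h ` {U. U \<subseteq> V \<and> card U = w}"
        then show "T \<in> {U. U \<subseteq> V \<and> card U = w}"
          using inj img by (auto simp: card_image inj_on_subset)
      next
        fix T assume T: "T \<in> {U. U \<subseteq> V \<and> card U = w}"
        then obtain U where U: "U \<subseteq> V" "T = h ` U"
          using img(1) by (metis (no_types, lifting) mem_Collect_eq subset_imageE)
        then show "T \<in> image h ` {U. U \<subseteq> V \<and> card U = w}"
          using T inj by (auto simp: card_image inj_on_subset)
      qed
    qed
    show "(\<Sum>U | U \<subseteq> V \<and> card U = w. walsh S' (h ` U)) = (\<Sum>U | U \<subseteq> V \<and> card U = w. walsh S U)"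
    proof (rule sum.cong[OF refl])
      fix U assume "U \<in> {U. U \<subseteq> V \<and> card U = w}"
      then have U: "U \<subseteq> V" by simp
      have "S' \<inter> h ` U = h ` (S \<inter> U)"
        using inj_on_image_Int[OF inj S(1) U] img by simp
      moreover have "card (h ` (S \<inter> U)) = card (S \<inter> U)"
        using inj S by (intro card_image) (meson inj_on_subset le_infI1)
      ultimately show "walsh S' (h ` U) = walsh S U" by (simp add: walsh_def)
    qed
  qed
qed

text \<open>For each \<open>w\<close>-set \<open>U\<close> the two characters multiply to
  \<open>(-1) ^ w\<close>, which is 1.\<close>

lemma krawtchouk_compl:
  assumes V: "finite V" and S: "S \<subseteq> V" and w: "even w"
  shows "krawtchouk V w (V - S) = krawtchouk V w S"
  unfolding krawtchouk_def
proof (rule sum.cong[OF refl])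
  fix U assume "U \<in> {U. U \<subseteq> V \<and> card U = w}"
  then have U: "U \<subseteq> V" "card U = w" by auto
  then have "finite U" using V finite_subset by blast
  then have "card U = card (S \<inter> U) + card ((V - S) \<inter> U)"
    using U by (subst card_Un_disjoint[symmetric]) (auto intro!: arg_cong[where f = card])
  then have "walsh S U * walsh (V - S) U = 1"
    using w U by (simp add: walsh_def flip: power_add)
  then have "walsh S U * (walsh S U * walsh (V - S) U) = walsh S U" by simp
  then show "walsh (V - S) U = walsh S U" by (simp add: mult.assoc[symmetric])
qed

text \<open>As a function of \<open>S\<close>, \<open>krawtchouk V w\<close> is an eigenfunction of
  the cube graph: toggling \<open>i\<close> in \<open>S\<close> flips the sign of
  \<open>walsh S U\<close> exactly for \<open>i\<close> in \<open>U\<close>, so each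
  \<open>U\<close> contributes the factor \<open>card V - 2 * w\<close>.\<close>

lemma sum_krawtchouk_neighbours:
  assumes V: "finite V" and S: "S \<subseteq> V"
  shows "(real (card V) - 2 * real w) * krawtchouk V w S =
    (\<Sum>i\<in>V. krawtchouk V w (sym_diff S {i}))"
proof -
  have walsh: "walsh (sym_diff S {i}) U = walsh S U * (if i \<in> U then -1 else 1)"
    if U: "U \<subseteq> V" for i U
  proof -
    have "finite U" using V U finite_subset by blast
    then have "walsh U (sym_diff S {i}) = walsh U S * walsh U {i}"
      by (rule walsh_sym_diff)
    then show ?thesis by (simp add: walsh_def Int_commute)
  qed
  have signs: "(\<Sum>i\<in>V. if i \<in> U then -1 else 1 :: real) = real (card V) - 2 * real (card U)"
    if U: "U \<subseteq> V" for U
  proof -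
    have "V \<inter> U = U" using U by auto
    moreover have "card (V - U) + card U = card V"
      using V U by (metis add.commute card_mono card_Diff_subset finite_subset le_add_diff_inverse)
    ultimately show ?thesis
      using V by (simp add: sum.If_cases Diff_eq[symmetric] flip: of_nat_add)
  qed
  have "(\<Sum>i\<in>V. krawtchouk V w (sym_diff S {i})) =
      (\<Sum>U | U \<subseteq> V \<and> card U = w. \<Sum>i\<in>V. walsh (sym_diff S {i}) U)"
    unfolding krawtchouk_def by (rule sum.swap)
  also have "\<dots> = (\<Sum>U | U \<subseteq> V \<and> card U = w. (real (card V) - 2 * real w) * walsh S U)"
  proof (rule sum.cong[OF refl])
    fix U assume "U \<in> {U. U \<subseteq> V \<and> card U = w}"
    then show "(\<Sum>i\<in>V. walsh (sym_diff S {i}) U) = (real (card V) - 2 * real w) * walsh S U"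
      using signs[of U] by (simp add: walsh mult.commute flip: sum_distrib_left)
  qed
  finally show ?thesis by (simp add: krawtchouk_def sum_distrib_left)
qed

text \<open>\<open>S\<close> picks one representative of each size. Among the neighbours of
  \<open>S j\<close>, \<open>j\<close> have size \<open>j - 1\<close> and the others size
  \<open>j + 1\<close>. For \<open>j = 0\<close> the truncated \<open>j - 1\<close> carries the
  coefficient 0.\<close>

lemma krawtchouk_recurrence:
  assumes V: "finite V" and S: "\<And>j. j \<le> card V \<Longrightarrow> S j \<subseteq> V \<and> card (S j) = j"
    and j: "j < card V"
  shows "(real (card V) - 2 * real w) * krawtchouk V w (S j) =
    (real (card V) - real j) * krawtchouk V w (S (j + 1)) + real j * krawtchouk V w (S (j - 1))"
proof -
  have Sj: "S j \<subseteq> V" "card (S j) = j" "finite (S j)"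
    using S[of j] j V finite_subset by auto
  have "(\<Sum>i\<in>V. krawtchouk V w (sym_diff (S j) {i})) =
      (\<Sum>i\<in>V. if i \<in> S j then krawtchouk V w (S (j - 1)) else krawtchouk V w (S (j + 1)))"
  proof (rule sum.cong[OF refl])
    fix i assume i: "i \<in> V"
    show "krawtchouk V w (sym_diff (S j) {i}) =
      (if i \<in> S j then krawtchouk V w (S (j - 1)) else krawtchouk V w (S (j + 1)))"
    proof (cases "i \<in> S j")
      case True
      then have "sym_diff (S j) {i} = S j - {i}" by auto
      moreover have "krawtchouk V w (S j - {i}) = krawtchouk V w (S (j - 1))"
        using True Sj S[of "j - 1"] j V by (intro krawtchouk_cong_card) auto
      ultimately show ?thesis using True by simp
    next
      case False
      then have "sym_diff (S j) {i} = insert i (S j)" by auto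
      moreover have "krawtchouk V w (insert i (S j)) = krawtchouk V w (S (j + 1))"
        using False Sj S[of "j + 1"] j V i by (intro krawtchouk_cong_card) auto
      ultimately show ?thesis using False by simp
    qed
  qed
  also have "\<dots> = real (card (V \<inter> S j)) * krawtchouk V w (S (j - 1)) +
      real (card (V \<inter> - S j)) * krawtchouk V w (S (j + 1))"
    using V by (simp add: sum.If_cases)
  also have "V \<inter> S j = S j" using Sj by auto
  also have "V \<inter> - S j = V - S j" by auto
  also have "real (card (V - S j)) = real (card V) - real j"
    using Sj j by (simp add: card_Diff_subset)
  finally show ?thesis
    using sum_krawtchouk_neighbours[OF V Sj(1), of w] Sj by simp
qed

text \<open>
  For \<open>j \<le> w\<close> the recurrence propagates the lower bound \<open>\<rho>\<close> on the ratio of consecutive values as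
  soon as \<open>6 \<rho>\<^sup>2 - 5 \<rho> + 1 \<le> 0\<close>, that is, \<open>1 / 3 \<le> \<rho> \<le> 1 / 2\<close>. The proof takes \<open>\<rho> = 2 / 5\<close>.
\<close>

lemma krawtchouk_pos:
  assumes V: "finite V" and n: "card V = 7 * w" and S: "S \<subseteq> V" "card S \<le> w"
  shows "krawtchouk V w S > 0"
proof -
  have "\<exists>T. T \<subseteq> V \<and> card T = j" if "j \<le> card V" for j
    using obtain_subset_with_card_n[OF that] by blast
  then obtain T where T: "\<And>j. j \<le> card V \<Longrightarrow> T j \<subseteq> V \<and> card (T j) = j"
    by metis
  define k where "k j = krawtchouk V w (T j)" for j
  have T0: "T 0 = {}" using T[of 0] V finite_subset by fastforce
  have k0: "k 0 > 0"
    using V n by (simp add: k_def T0 krawtchouk_empty zero_less_binomial)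
  have rec: "5 * real w * k j = (7 * real w - real j) * k (j + 1) + real j * k (j - 1)"
    if "j < 7 * w" for j
    using krawtchouk_recurrence[of V T j w] that n V T by (simp add: k_def)
  have "k j > 0 \<and> (j < w \<longrightarrow> k (j + 1) \<ge> 2 / 5 * k j)" if "j \<le> w" for j
    using that
  proof (induction j)
    case 0
    \<comment> \<open>At 0 the recurrence reads \<open>5 * w * k 0 = 7 * w * k 1\<close>, so the
      first ratio is 5/7.\<close>
    show ?case using k0 rec[of 0] by auto
  next
    case (Suc j)
    then have kj: "k j > 0" "k (j + 1) \<ge> 2 / 5 * k j" by auto
    then have pos: "k (Suc j) > 0" by simp
    moreover have "k (Suc j + 1) \<ge> 2 / 5 * k (Suc j)" if w: "Suc j < w"
    proof -
      have w': "real j + 1 < real w" using w by linarith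
      have eq: "(7 * real w - (real j + 1)) * k (Suc j + 1) =
          5 * real w * k (Suc j) - (real j + 1) * k j"
        using rec[of "Suc j"] w by (simp add: add.commute)
      have "(real j + 1) * k j \<le> (real j + 1) * (5 / 2 * k (Suc j))"
        using kj by (intro mult_left_mono) auto
      moreover have "2 / 5 * k (Suc j) * (7 * real w - (real j + 1)) \<le>
          (5 * real w - 5 / 2 * (real j + 1)) * k (Suc j)"
      proof -
        \<comment> \<open>With t = j + 1 this amounts to 21 t <= 22 w, which follows from t <
          w.\<close>
        have "2 / 5 * (7 * real w - (real j + 1)) \<le> 5 * real w - 5 / 2 * (real j + 1)"
          using w' by (simp add: field_simps)
        from mult_right_mono[OF this, of "k (Suc j)"] pos show ?thesis
          by (simp add: mult_ac)
      qed
      moreover have "(5 * real w - 5 / 2 * (real j + 1)) * k (Suc j) =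
          5 * real w * k (Suc j) - (real j + 1) * (5 / 2 * k (Suc j))"
        by (simp add: algebra_simps)
      ultimately have "2 / 5 * k (Suc j) * (7 * real w - (real j + 1)) \<le>
          (7 * real w - (real j + 1)) * k (Suc j + 1)"
        using eq by linarith
      then have "2 / 5 * k (Suc j) * (7 * real w - (real j + 1)) \<le>
          k (Suc j + 1) * (7 * real w - (real j + 1))"
        by (simp only: mult.commute)
      moreover have "7 * real w - (real j + 1) > 0" using w' by linarith
      ultimately show ?thesis by (rule mult_right_le_imp_le)
    qed
    ultimately show ?case by blast
  qed
  then have "k (card S) > 0" using S by blast
  moreover have "card S \<le> card V" using S V card_mono by blast
  then have "krawtchouk V w S = k (card S)"
    unfolding k_def using V S T by (intro krawtchouk_cong_card) auto
  ultimately show ?thesis by simp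
qed

text \<open>
  By Parseval the values at the \<open>card V choose card S\<close> sets of the size of \<open>S\<close> cannot all be large.
\<close>

lemma krawtchouk_sq_le:
  assumes V: "finite V" and S: "S \<subseteq> V"
  shows "(card V choose card S) * (krawtchouk V w S)\<^sup>2 \<le> 2 ^ card V * (card V choose w)"
proof -
  let ?B = "{S'. S' \<subseteq> V \<and> card S' = card S}"
  have "real (card V choose card S) * (krawtchouk V w S)\<^sup>2 = (\<Sum>S'\<in>?B. (krawtchouk V w S)\<^sup>2)"
    using V by (simp add: n_subsets)
  also have "\<dots> = (\<Sum>S'\<in>?B. (krawtchouk V w S')\<^sup>2)"
    using krawtchouk_cong_card[OF V S] by (intro sum.cong) auto
  also have "\<dots> \<le> (\<Sum>S'\<in>Pow V. (krawtchouk V w S')\<^sup>2)"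
    using V by (intro sum_mono2) auto
  \<comment> \<open>Parseval for the family of all \<open>w\<close>-subsets, whose transform is
    \<open>krawtchouk V w\<close>.\<close>
  also have "\<dots> = 2 ^ card V * real (card {U. U \<subseteq> V \<and> card U = w})"
    using parseval_walsh[OF V, of "{U. U \<subseteq> V \<and> card U = w}"] by (auto simp: krawtchouk_def)
  finally show ?thesis using V by (simp add: n_subsets)
qed

lemma binomial_le_binomial_middle:
  fixes k l n :: nat
  assumes "k \<le> l" "l \<le> n - k" "k \<le> n"
  shows "n choose k \<le> n choose l"
proof (cases "2 * l \<le> n")
  case True
  then show ?thesis using assms by (intro binomial_mono) auto
next
  case False
  have "n choose k \<le> n choose (n - l)"
    using assms False by (intro binomial_mono) auto
  also have "\<dots> = n choose l"
    using assms by (intro binomial_symmetric[symmetric]) auto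
  finally show ?thesis .
qed

text \<open>Within \<open>w\<close> of either end the value is positive, by
  \<open>krawtchouk_pos\<close> and complementation. In between, \<open>7 * w choose card S\<close>
  is at least \<open>7 * w choose w\<close>, so the Parseval bound leaves a square of at most
  \<open>2 ^ (7 * w)\<close>.\<close>

lemma krawtchouk_ge:
  assumes V: "finite V" and n: "card V = 7 * w" and w: "even w" and S: "S \<subseteq> V"
  shows "krawtchouk V w S \<ge> - sqrt (2 ^ (7 * w))"
proof -
  have cS: "card S \<le> 7 * w" using V S n card_mono by metis
  have cc: "card (V - S) = 7 * w - card S"
    using V S n by (simp add: card_Diff_subset finite_subset)
  consider "card S \<le> w" | "7 * w - w \<le> card S" | "w \<le> card S" "card S \<le> 7 * w - w"
    by linarith
  then show ?thesis
  proof cases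
    case 1
    have "krawtchouk V w S > 0" using krawtchouk_pos[OF V n S 1] .
    then show ?thesis by (smt (verit) real_sqrt_ge_zero zero_le_power)
  next
    case 2
    have "krawtchouk V w (V - S) > 0" using V n 2 cc by (intro krawtchouk_pos) auto
    then have "krawtchouk V w S > 0" using krawtchouk_compl[OF V S w] by simp
    then show ?thesis by (smt (verit) real_sqrt_ge_zero zero_le_power)
  next
    case 3
    have pos: "real (7 * w choose w) > 0" by simp
    have "real (7 * w choose w) * (krawtchouk V w S)\<^sup>2 \<le>
        real (7 * w choose card S) * (krawtchouk V w S)\<^sup>2"
      using 3 by (intro mult_right_mono of_nat_mono binomial_le_binomial_middle) auto
    also have "\<dots> \<le> 2 ^ (7 * w) * real (7 * w choose w)"
      using krawtchouk_sq_le[OF V S, of w] n by simp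
    finally have "(krawtchouk V w S)\<^sup>2 \<le> 2 ^ (7 * w)"
      using pos by (simp add: mult.commute)
    then have "\<bar>krawtchouk V w S\<bar> \<le> sqrt (2 ^ (7 * w))"
      by (metis real_sqrt_abs real_sqrt_le_mono)
    then show ?thesis by linarith
  qed
qed

subsection \<open>Triangle-free families of sets\<close>

lemma card_sym_diff:
  assumes "finite u" "finite v"
  shows "card (sym_diff u v) + 2 * card (u \<inter> v) = card u + card v"
proof -
  have "card u = card (u - v) + card (u \<inter> v)" "card v = card (v - u) + card (u \<inter> v)"
    using assms by (simp_all add: card_Diff_subset_Int card_mono Int_commute)
  moreover have "card (sym_diff u v) = card (u - v) + card (v - u)"
    using assms by (intro card_Un_disjoint) auto
  ultimately show ?thesis by linarith
qed

text \<open>Translation by \<open>x\<close> turns its neighbours into \<open>2 * q\<close>-sets. Two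
  of these are at distance \<open>2 * q\<close> exactly when they meet in \<open>q\<close> points,
  and that would complete a triangle with \<open>x\<close>.\<close>

lemma card_triangle_free_nbhd_le:
  fixes q r :: nat
  assumes V: "finite V" "card V = 14 * q" and q: "q = 2 ^ r" and A: "A \<subseteq> Pow V"
    and free: "\<And>x y z. x \<in> A \<Longrightarrow> y \<in> A \<Longrightarrow> z \<in> A \<Longrightarrow> card (sym_diff x y) = 2 * q \<Longrightarrow>
      card (sym_diff y z) = 2 * q \<Longrightarrow> card (sym_diff z x) \<noteq> 2 * q"
    and x: "x \<in> A"
  shows "card {y \<in> A. card (sym_diff x y) = 2 * q} \<le> 7 * (14 * q choose (q - 1))"
proof -
  let ?N = "{y \<in> A. card (sym_diff x y) = 2 * q}"
  let ?F = "sym_diff x ` ?N"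
  have "inj_on (sym_diff x) ?N"
    by (rule inj_onI) blast
  then have "card ?F = card ?N"
    by (rule card_image)
  moreover have "2 * q * card ?F \<le> card V * (card V choose (q - 1))"
  proof (rule card_forbidden_half_intersection_le[OF V(1) q])
    fix u assume "u \<in> ?F"
    then show "u \<subseteq> V \<and> card u = 2 * q" using A x by auto
  next
    fix u v assume "u \<in> ?F" "v \<in> ?F"
    then obtain y z where y: "y \<in> A" "card u = 2 * q" "u = sym_diff x y"
      and z: "z \<in> A" "card v = 2 * q" "v = sym_diff x z"
      by auto
    show "card (u \<inter> v) \<noteq> q"
    proof
      assume int: "card (u \<inter> v) = q"
      have "u \<subseteq> V" "v \<subseteq> V" using A x y z by auto
      then have "finite u" "finite v" using V finite_subset by auto
      then have "card (sym_diff u v) = 2 * q"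
        using card_sym_diff[of u v] int y z by linarith
      moreover have "sym_diff u v = sym_diff y z" using y z by blast
      moreover have "sym_diff z x = sym_diff x z" by blast
      ultimately show False using free[OF x y(1) z(1)] y z by simp
    qed
  qed
  ultimately have "q * (2 * card ?N) \<le> q * (14 * (14 * q choose (q - 1)))"
    using V by (simp add: mult_ac)
  then show ?thesis using q by simp
qed

text \<open>An eigenvalue bound of Hoffman type: the pairs of \<open>A\<close> at distance
  \<open>2 * q\<close> are counted from above by neighbourhoods and from below by the
  spectrum.\<close>

lemma card_triangle_free_le:
  fixes q r :: nat
  assumes V: "finite V" "card V = 14 * q" and q: "q = 2 ^ r" and A: "A \<subseteq> Pow V"
    and free: "\<And>x y z. x \<in> A \<Longrightarrow> y \<in> A \<Longrightarrow> z \<in> A \<Longrightarrow> card (sym_diff x y) = 2 * q \<Longrightarrow>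
      card (sym_diff y z) = 2 * q \<Longrightarrow> card (sym_diff z x) \<noteq> 2 * q"
  shows "card A * (14 * q choose (2 * q)) \<le>
    2 ^ (14 * q) * (7 * (14 * q choose (q - 1)) + 2 ^ (7 * q))"
proof (cases "A = {}")
  case False
  have finA: "finite A" using A V by (meson finite_Pow_iff finite_subset)
  let ?a = "\<lambda>S. \<Sum>x\<in>A. walsh S x"
  let ?K = "krawtchouk V (2 * q)"
  let ?D = "7 * (14 * q choose (q - 1))"
  define M :: real where "M = 2 ^ (7 * q)"
  define E where "E = card {(x, y). x \<in> A \<and> y \<in> A \<and> card (sym_diff x y) = 2 * q}"
  have M: "sqrt (2 ^ (14 * q)) = M"
  proof -
    have "(2::real) ^ (14 * q) = M\<^sup>2"
      by (simp add: M_def flip: power_mult)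
    then show ?thesis by (simp add: M_def)
  qed
  have "E = card (SIGMA x:A. {y \<in> A. card (sym_diff x y) = 2 * q})"
    unfolding E_def by (rule arg_cong[where f = card]) auto
  also have "\<dots> = (\<Sum>x\<in>A. card {y \<in> A. card (sym_diff x y) = 2 * q})"
    using finA by (intro card_SigmaI) auto
  also have "\<dots> \<le> (\<Sum>x\<in>A. ?D)"
    using card_triangle_free_nbhd_le[OF V q A free] by (rule sum_mono)
  finally have "E \<le> card A * ?D" by simp
  then have E: "real E \<le> real (card A * ?D)"
    by (simp only: of_nat_le_iff)
  \<comment> \<open>Shifting all eigenvalues by \<open>M\<close> makes every summand nonnegative, so
    the term at the empty set, where \<open>?a {}\<close> is \<open>card A\<close>, is a lower bound
    for the sum. Parseval gives the cost of the shift.\<close>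
  have "(card A)\<^sup>2 * (14 * q choose (2 * q)) \<le> (?a {})\<^sup>2 * (?K {} + M)"
    using V by (simp add: krawtchouk_empty walsh_def M_def mult_left_mono)
  also have "\<dots> \<le> (\<Sum>S\<in>Pow V. (?a S)\<^sup>2 * (?K S + M))"
  proof (rule member_le_sum)
    fix S assume "S \<in> Pow V - {{}}"
    then have "?K S \<ge> - M"
      using krawtchouk_ge[OF V(1), of "2 * q" S] V(2) M by simp
    then show "0 \<le> (?a S)\<^sup>2 * (?K S + M)" by simp
  qed (use V in auto)
  also have "\<dots> = (\<Sum>S\<in>Pow V. (?a S)\<^sup>2 * ?K S) + M * (\<Sum>S\<in>Pow V. (?a S)\<^sup>2)"
    by (simp add: distrib_left sum.distrib sum_distrib_left mult.commute)
  also have "\<dots> = 2 ^ (14 * q) * real E + M * (2 ^ (14 * q) * real (card A))"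
    using sum_walsh_transform_sq_krawtchouk[OF V(1) A, of "2 * q"] parseval_walsh[OF V(1) A]
    by (simp add: V E_def)
  also have "\<dots> \<le> 2 ^ (14 * q) * real (card A * ?D) + M * (2 ^ (14 * q) * real (card A))"
    by (rule add_right_mono, rule mult_left_mono[OF E]) simp
  also have "\<dots> = card A * (2 ^ (14 * q) * (?D + M))"
    by (simp add: algebra_simps)
  finally have "real (card A) * (real (card A) * (14 * q choose (2 * q))) \<le>
      card A * (2 ^ (14 * q) * (?D + M))"
    by (simp add: power2_eq_square mult.assoc)
  moreover have "real (card A) > 0" using False finA by (simp add: card_gt_0_iff)
  ultimately have "real (card A) * (14 * q choose (2 * q)) \<le> 2 ^ (14 * q) * (?D + M)"
    by simp
  then have "real (card A * (14 * q choose (2 * q))) \<le>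
      real (2 ^ (14 * q) * (?D + 2 ^ (7 * q)))"
    by (simp add: M_def)
  then show ?thesis by linarith
qed simp

subsection \<open>Binomial coefficient estimates\<close>

text \<open>Each step up to \<open>l\<close> multiplies the coefficient by at least 6, because
  \<open>n - l\<close> is at least \<open>6 * Suc l\<close> as long as
  \<open>7 * Suc l \<le> n\<close>.\<close>

lemma six_power_mult_binomial_le:
  fixes k l n :: nat
  assumes "k \<le> l" "7 * l \<le> n"
  shows "6 ^ (l - k) * (n choose k) \<le> n choose l"
  using assms
proof (induction l rule: dec_induct)
  case (step l)
  have "6 * Suc l * (n choose l) \<le> (n - l) * (n choose l)"
    using step.prems by (intro mult_right_mono) auto
  also have "\<dots> = Suc l * (n choose Suc l)"
    by (simp only: binomial_absorption binomial_absorb_comp)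
  finally have "Suc l * (6 * (n choose l)) \<le> Suc l * (n choose Suc l)"
    by (simp only: mult_ac)
  then have "6 * (n choose l) \<le> n choose Suc l"
    by (simp only: mult_le_cancel1 zero_less_Suc)
  moreover have "6 ^ (l - k) * (n choose k) \<le> n choose l"
    using step by simp
  ultimately show ?case
    using step.hyps by (simp add: Suc_diff_le)
qed simp

lemma fact_add_eq:
  "(fact (m + k) :: real) = fact m * (\<Prod>i=1..k. real m + real i)"
  by (induction k) (simp_all add: algebra_simps)

text \<open>Consecutive coefficients have a ratio that tends to 7^7 / 6^6, about 17.65, and is at
  least 16 from \<open>w = 8\<close> on. The factor 4 makes the bound true at the start.\<close>

lemma binomial_seven_ge:
  fixes w :: nat
  assumes "w \<ge> 8"
  shows "16 ^ w \<le> 4 * (7 * w choose w)"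
  using assms
proof (induction w rule: dec_induct)
  case base
  have "(7 * 8 choose 8 :: nat) = 1420494075"
    by (simp add: binomial_code fold_atLeastAtMost_nat.simps fact_numeral)
  then show ?case by simp
next
  case (step w)
  define c d where "c = real (7 * w choose w)" and "d = real (7 * Suc w choose Suc w)"
  define P Q where "P = (\<Prod>i=1..6. 6 * real w + real i)"
    and "Q = (\<Prod>i=1..6. 7 * real w + real i)"
  have P: "P > 0" unfolding P_def by (intro prod_pos) auto
  have "7 * Suc w - Suc w = 6 * w + 6" "7 * w - w = 6 * w" by auto
  then have cd: "c = fact (7 * w) / (fact w * fact (6 * w))"
    "d = fact (7 * w + 7) / (fact (Suc w) * fact (6 * w + 6))"
    by (simp_all add: c_def d_def binomial_fact algebra_simps del: fact_Suc)
  have f7: "(fact (7 * w + 7) :: real) = fact (7 * w) * (Q * (7 * real w + 7))"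
    using fact_add_eq[of "7 * w" 7] prod.cl_ivl_Suc[of "\<lambda>i. 7 * real w + real i" 1 6] by (simp add: Q_def)
  have f6: "(fact (6 * w + 6) :: real) = fact (6 * w) * P"
    using fact_add_eq[of "6 * w" 6] by (simp add: P_def)
  have f1: "(fact (Suc w) :: real) = (real w + 1) * fact w"
    by (simp add: add.commute)
  have "7 * real w + 7 = 7 * (real w + 1)" "real w + 1 > 0"
    by auto
  then have "d = c * (7 * (Q / P))"
    unfolding cd f7 f6 f1 using P by (simp add: divide_simps)
  moreover have "16 \<le> 7 * (Q / P)"
  proof -
    \<comment> \<open>The quotient (7 w + i) / (6 w + i) grows with w and falls with i; 31/27 =
      62/54 is its value at w = 8, i = 6.\<close>
    have "(\<Prod>i=1..6::nat. 31 / 27 * (6 * real w + real i)) \<le> Q"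
      unfolding Q_def using step.hyps by (intro prod_mono) auto
    also have "(\<Prod>i=1..6::nat. 31 / 27 * (6 * real w + real i)) = (31 / 27) ^ 6 * P"
      unfolding P_def by (simp only: prod.distrib prod_constant card_atLeastAtMost) simp
    finally have "(31 / 27) ^ 6 \<le> Q / P"
      using P by (simp only: pos_le_divide_eq)
    moreover have "16 \<le> 7 * (31 / 27 :: real) ^ 6"
      by (simp add: power_divide)
    ultimately show ?thesis by linarith
  qed
  ultimately have "16 * c \<le> d"
    using mult_left_mono[of 16 "7 * (Q / P)" c] by (simp add: c_def mult.commute)
  moreover have "16 ^ w \<le> 4 * c"
    using step.IH unfolding c_def by (metis of_nat_le_iff of_nat_mult of_nat_numeral of_nat_power)
  ultimately have "16 ^ Suc w \<le> 4 * d" by simp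
  then have "real (16 ^ Suc w) \<le> real (4 * (7 * Suc w choose Suc w))"
    by (simp only: d_def of_nat_mult of_nat_numeral of_nat_power)
  then show ?case by linarith
qed

subsection \<open>Colorings of space\<close>

lemma euclid_dist_scaled_indicator:
  assumes "x \<subseteq> {..<n}" "y \<subseteq> {..<n}" "s \<ge> 0"
  shows "euclid_dist n (\<lambda>i. if i \<in> x then s else 0) (\<lambda>i. if i \<in> y then s else 0) =
    s * sqrt (card (sym_diff x y))"
proof -
  have "(\<Sum>i<n. ((if i \<in> x then s else 0) - (if i \<in> y then s else 0))\<^sup>2) =
      (\<Sum>i<n. if i \<in> sym_diff x y then s\<^sup>2 else 0)"
    by (rule sum.cong) auto
  also have "\<dots> = card ({..<n} \<inter> sym_diff x y) * s\<^sup>2"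
    by (subst sum.inter_restrict[symmetric]) simp_all
  also have "{..<n} \<inter> sym_diff x y = sym_diff x y"
    using assms by auto
  finally show ?thesis
    using assms(3) by (simp add: euclid_dist_def L2_set_def real_sqrt_mult)
qed

text \<open>The color classes cover the embedded cube, so adding their density bounds gives
  \<open>?C \<le> k * ?B\<close>. The two summands of \<open>?B\<close>, multiplied by
  \<open>2 ^ q\<close>, are at most \<open>2 * ?C\<close> and \<open>4 * ?C\<close>; hence the
  factor 6.\<close>

lemma triangle_colorable_lower_bound:
  fixes q r n k :: nat
  assumes q: "q = 2 ^ r" "q \<ge> 4" and n: "14 * q \<le> n" and col: "triangle_colorable n k"
  shows "2 ^ q \<le> 6 * k"
proof -
  obtain f where f: "f \<in> topspace (Euclidean_space n) \<rightarrow> {..<k}"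
    and no: "\<And>x y z. \<not> mono_unit_triangle n f x y z"
    using col by (auto simp: triangle_colorable_def)
  define V where "V = {..<14 * q}"
  have V: "finite V" "card V = 14 * q" by (auto simp: V_def)
  define pt where "pt x = (\<lambda>i. if i \<in> x then 1 / sqrt (2 * q) else 0)" for x :: "nat set"
  have space: "pt x \<in> topspace (Euclidean_space n)" if "x \<in> Pow V" for x
    using that n by (auto simp: pt_def V_def topspace_Euclidean_space)
  have dist: "euclid_dist n (pt x) (pt y) = 1"
    if "x \<in> Pow V" "y \<in> Pow V" "card (sym_diff x y) = 2 * q" for x y
  proof -
    have "x \<subseteq> {..<n}" "y \<subseteq> {..<n}" using that n by (auto simp: V_def)
    then show ?thesis
      using euclid_dist_scaled_indicator[of x n y "1 / sqrt (2 * q)"] that q(2) by (simp add: pt_def)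
  qed
  let ?A = "\<lambda>c. {x \<in> Pow V. f (pt x) = c}"
  let ?C = "14 * q choose (2 * q)" and ?D = "14 * q choose (q - 1)"
  let ?B = "7 * ?D + 2 ^ (7 * q)"
  have bound: "card (?A c) * ?C \<le> 2 ^ (14 * q) * ?B" for c
  proof (rule card_triangle_free_le[OF V q(1)])
    fix x y z
    assume "x \<in> ?A c" "y \<in> ?A c" "z \<in> ?A c"
      and "card (sym_diff x y) = 2 * q" "card (sym_diff y z) = 2 * q"
    then show "card (sym_diff z x) \<noteq> 2 * q"
      using no[of "pt x" "pt y" "pt z"] space dist by (auto simp: mono_unit_triangle_def)
  qed auto
  have "f (pt x) < k" if "x \<in> Pow V" for x
    using PiE[OF f, of "pt x"] space[OF that] by auto
  then have "Pow V = (\<Union>c<k. ?A c)"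
    by blast
  then have "card (Pow V) = card (\<Union>c<k. ?A c)"
    by (rule arg_cong)
  also have "\<dots> \<le> (\<Sum>c<k. card (?A c))"
    by (rule card_UN_le) simp
  finally have "2 ^ (14 * q) \<le> (\<Sum>c<k. card (?A c))"
    using V by (simp add: card_Pow)
  then have "2 ^ (14 * q) * ?C \<le> (\<Sum>c<k. card (?A c)) * ?C"
    by (rule mult_right_mono) simp
  also have "\<dots> = (\<Sum>c<k. card (?A c) * ?C)"
    by (rule sum_distrib_right)
  also have "\<dots> \<le> (\<Sum>c<k. 2 ^ (14 * q) * ?B)"
    using bound by (rule sum_mono)
  also have "\<dots> = 2 ^ (14 * q) * (k * ?B)"
    by (simp only: sum_constant card_lessThan mult_ac of_nat_id)
  finally have C_le: "?C \<le> k * ?B" by simp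
  have "2 ^ q * (7 * ?D) \<le> 2 * (6 ^ (q + 1) * ?D)"
  proof -
    have "7 * 2 ^ q \<le> 12 * (6::nat) ^ q"
      by (intro mult_mono power_mono) auto
    from mult_right_mono[OF this, of ?D] show ?thesis by (simp add: mult_ac)
  qed
  also have "2 * (6 ^ (q + 1) * ?D) \<le> 2 * ?C"
    using six_power_mult_binomial_le[of "q - 1" "2 * q" "14 * q"] q(2) by (simp add: mult.assoc)
  finally have "2 ^ q * (7 * ?D) \<le> 2 * ?C" .
  \<comment> \<open>The left side is \<open>16 ^ (2 * q)\<close>, so
    \<open>binomial_seven_ge\<close> applies with \<open>w = 2 * q\<close>; \<open>q \<ge> 4\<close>
    provides its hypothesis.\<close>
  moreover have "2 ^ q * 2 ^ (7 * q) \<le> 4 * ?C"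
  proof -
    have "(2::nat) ^ q * 2 ^ (7 * q) = 2 ^ (4 * (2 * q))"
      by (simp flip: power_add)
    also have "\<dots> = 16 ^ (2 * q)"
      by (subst power_mult) simp
    finally show ?thesis
      using binomial_seven_ge[of "2 * q"] q(2) by simp
  qed
  ultimately have "2 ^ q * ?B \<le> 6 * ?C"
    by (simp only: distrib_left)
  also have "\<dots> \<le> 6 * k * ?B"
    using C_le by simp
  finally show ?thesis
    by (simp only: mult_le_cancel2) simp
qed

lemma chi_triangle_gt:
  assumes "n \<ge> 112"
  shows "real (chi_triangle n) > 1.01446 ^ n"
proof -
  have "1 \<le> n div 14" using assms by linarith
  \<comment> \<open>This makes \<open>q\<close> the largest power of two with
    \<open>14 * q \<le> n\<close>; since 112 = 14 * 8, it is at least 8.\<close>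
  from ex_power_ivl1[of 2, OF _ this] obtain r where r: "2 ^ r \<le> n div 14" "n div 14 < 2 ^ (r + 1)"
    by auto
  define q :: nat where "q = 2 ^ r"
  have n: "14 * q \<le> n" "n \<le> 28 * q" using r by (auto simp: q_def)
  have "8 < (2::nat) ^ (r + 1)" using r assms by linarith
  then have "(2::nat) ^ 3 < 2 ^ (r + 1)" by simp
  then have "3 < r + 1" by (rule power_less_imp_less_exp[rotated]) simp
  then have "(2::nat) ^ 3 \<le> 2 ^ r" by (intro power_increasing) auto
  then have q8: "q \<ge> 8" by (simp add: q_def)
  have "triangle_colorable n (chi_triangle n)"
    unfolding chi_triangle_def using triangle_colorable_exists by (rule LeastI_ex)
  then have "2 ^ q \<le> 6 * chi_triangle n"
    using q8 n by (intro triangle_colorable_lower_bound[OF q_def]) auto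
  then have "real (2 ^ q) \<le> real (6 * chi_triangle n)"
    by (rule of_nat_mono)
  then have chi: "2 ^ q \<le> 6 * real (chi_triangle n)" by simp
  have "(1.01446::real) ^ n \<le> 1.01446 ^ (28 * q)"
    using n by (intro power_increasing) auto
  also have "\<dots> = (1.01446 ^ 28) ^ q"
    by (rule power_mult)
  \<comment> \<open>1.01446^28 is about 1.495. Splitting 2 as 3/2 times 4/3 leaves
    \<open>(4 / 3) ^ q\<close>, which exceeds 6 once \<open>q \<ge> 8\<close>.\<close>
  also have "\<dots> \<le> (3 / 2) ^ q"
    by (rule power_mono) (simp_all add: power_divide)
  finally have "6 * (1.01446::real) ^ n \<le> 6 * (3 / 2) ^ q" by simp
  also have "\<dots> < (4 / 3) ^ q * (3 / 2) ^ q"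
  proof (rule mult_strict_right_mono)
    have "(6::real) < (4 / 3) ^ 8" by (simp add: power_divide)
    also have "\<dots> \<le> (4 / 3) ^ q" using q8 by (intro power_increasing) auto
    finally show "(6::real) < (4 / 3) ^ q" .
  qed simp
  also have "\<dots> = 2 ^ q"
    by (simp flip: power_mult_distrib)
  finally show ?thesis using chi by linarith
qed

text \<open>Covers the dimensions below 112 in the final bound.\<close>

lemma chi_triangle_pos: "chi_triangle n > 0"
proof (rule ccontr)
  assume "\<not> chi_triangle n > 0"
  moreover have "triangle_colorable n (chi_triangle n)"
    unfolding chi_triangle_def using triangle_colorable_exists by (rule LeastI_ex)
  ultimately have "triangle_colorable n 0" by simp
  moreover have "(\<lambda>i. 0) \<in> topspace (Euclidean_space n)"
    by (simp add: topspace_Euclidean_space)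
  ultimately show False by (auto simp: triangle_colorable_def)
qed

theorem theorem1:
  shows "\<exists>c::real. 0.01446 \<le> c \<and> c < 0.01447 \<and>
    (\<exists>\<epsilon>::nat \<Rightarrow> real. \<epsilon> \<longlonglongrightarrow> 0 \<and> (\<forall>n\<ge>1. real (chi_triangle n) > (1 + c + \<epsilon> n) ^ n)) \<and>
    (\<exists>\<epsilon>::nat \<Rightarrow> real. \<epsilon> \<longlonglongrightarrow> 0 \<and> (\<forall>n\<ge>1. real (chi_triangle n) > (1.01446 + \<epsilon> n) ^ n))"
proof -
  \<comment> \<open>Below 112 the error term makes the base 0, so for \<open>n \<ge> 1\<close> the
    power is 0 and positivity of \<open>chi_triangle n\<close> suffices.\<close>
  define \<epsilon> :: "nat \<Rightarrow> real" where "\<epsilon> n = (if n \<ge> 112 then 0 else - 1.01446)" for n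
  have "\<forall>\<^sub>F n in sequentially. \<epsilon> n = 0"
    using eventually_ge_at_top[of 112] by eventually_elim (simp add: \<epsilon>_def)
  then have lim: "\<epsilon> \<longlonglongrightarrow> 0"
    by (rule tendsto_eventually)
  have gt: "real (chi_triangle n) > (1.01446 + \<epsilon> n) ^ n" if "n \<ge> 1" for n
    using that chi_triangle_gt[of n] chi_triangle_pos[of n] by (simp add: \<epsilon>_def power_0_left)
  \<comment> \<open>With the witness \<open>c = 0.01446\<close> both bounds coincide, and one error
    term serves for both.\<close>
  have "(1::real) + 0.01446 = 1.01446" by simp
  then have "\<forall>n\<ge>1. real (chi_triangle n) > (1 + 0.01446 + \<epsilon> n) ^ n"
    using gt by (simp only:) simp
  moreover have "(0.01446::real) < 0.01447" by simp
  ultimately show ?thesis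
    using lim gt by (intro exI[of _ "0.01446"] conjI exI[of _ \<epsilon>]) blast+
qed

end
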